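(* Let $\alpha>0$ and let $n\ge0$ be an integer. If $$H_n(s):=s\frac{d}{ds}\ln D_n(s),$$ then for all $s>0$ $$(sH_n'')^2=\left[n-(2n+\alpha)H_n'\right]^2-4\left[n(n+\alpha)+sH_n'-H_n\right]H_n'(H_n'-1).$$
   Context: For $\alpha>0$ and $s>0$, $D_n(s)$ is the Hankel determinant $$D_n(s)=\det\left(\int_0^\infty x^{j+k}\,x^{\alpha}e^{-x-s/x}\,dx\right)_{j,k=0}^{n-1},\qquad D_0=1 .$$ Primes denote $d/ds$. *)

theory Defs
  imports "HOL-Analysis.Analysis" "Jordan_Normal_Form.Determinant"
begin

definition moment :: "real \<Rightarrow> real \<Rightarrow> nat \<Rightarrow> real" where
  "moment \<alpha> s m = (LINT x:{0<..}|lborel. x ^ m * (x powr \<alpha> * exp (- x - s / x)))"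

(* HOL-Analysis and Jordan_Normal_Form both provide a constant det; the latter works on
   matrices whose size is a natural number and gives 1 on the 0 x 0 matrix, so hankel_det _ 0 _ = 1. *)
definition hankel_det :: "real \<Rightarrow> nat \<Rightarrow> real \<Rightarrow> real" where
  "hankel_det \<alpha> n s = Determinant.det (Matrix.mat n n (\<lambda>(j, k). moment \<alpha> s (j + k)))"

(* For s > 0 the Hankel determinant is positive and smooth in s, so that ln and deriv are
   evaluated only where they have their usual meaning. *)
definition H :: "real \<Rightarrow> nat \<Rightarrow> real \<Rightarrow> real" where
  "H \<alpha> n s = s * deriv (\<lambda>t. ln (hankel_det \<alpha> n t)) s"

end

theory Submission imports Defs "HOL-Real_Asymp.Real_Asymp" begin

text \<open>
  Write \<open>\<langle>f\<rangle>\<close> for the integral of \<open>f\<close> against \<open>x powr a * exp (- x - s / x)\<close>, let \<open>P n\<close> be the monic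
  orthogonal polynomials, \<open>h n = \<langle>(P n)^2\<rangle>\<close>, \<open>v n = P n (0)\<close> and \<open>u n = \<langle>P n / x\<rangle>\<close>. By orthogonality
  \<open>\<langle>P n * P k / x\<rangle> = v k * u n\<close> for \<open>k \<le> n\<close>, so everything is expressed through
  \<open>A n = s * v n * u n / h n\<close>, \<open>B n = s * v (n-1) * u n / h (n-1)\<close> and the recurrence coefficients
  \<open>\<alpha> n\<close> and \<open>\<beta> n\<close>. Since \<open>D n\<close> is the product of the \<open>h j\<close> and \<open>h j' = - v j * u j\<close>, we have
  \<open>H n = - (A 0 + \<dots> + A (n-1))\<close>.

  Integration by parts of \<open>x * (P n)^2\<close> and \<open>x * P n * P (n-1)\<close> identifies \<open>\<alpha> n = 2 * n + 1 + a + A n\<close>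
  and \<open>\<beta> n = n * (n + a) + s * H n' - H n\<close>, where \<open>s * H n' = B n\<close>; the Casoratian
  \<open>v (n-1) * u n - v n * u (n-1) = h (n-1)\<close> yields \<open>\<beta> n * A n * A (n-1) = B n * (B n - s)\<close>, and
  differentiating \<open>\<beta> n = h n / h (n-1)\<close> gives \<open>s * H n'' = \<beta> n * (A (n-1) - A n) / s\<close>. The equation then
  reduces to the sum rule \<open>\<beta> n * (A n + A (n-1)) = n * s - (2 * n + a) * B n\<close>, which follows by induction
  on \<open>n\<close>: the difference of two consecutive instances, multiplied by \<open>A n > 0\<close>, is a polynomial
  identity.
\<close>

subsection \<open>Moments of the weight\<close>

text \<open>The exponent is an arbitrary real, so that multiplying or dividing by \<open>x\<close>
  merely shifts it.\<close>

definition weight :: "real \<Rightarrow> real \<Rightarrow> real \<Rightarrow> real" where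
  "weight b s x = x powr b * exp (- x - s / x)"

definition wmom :: "real \<Rightarrow> real \<Rightarrow> real" where
  "wmom b s = (LINT x:{0<..}|lborel. weight b s x)"

lemma weight_pos: "x > 0 \<Longrightarrow> weight b s x > 0"
  by (simp add: weight_def)

lemma weight_power: "x > 0 \<Longrightarrow> x ^ k * weight b s x = weight (b + real k) s x"
  by (simp add: weight_def powr_add powr_realpow)

lemma weight_measurable [measurable]: "weight b s \<in> borel_measurable borel"
  unfolding weight_def by measurable

lemma exp_bound_power:
  fixes y :: real
  assumes "y \<ge> 0"
  shows "y ^ k * exp (- y) \<le> fact k"
proof -
  have "(\<Sum>n\<in>{k}. inverse (fact n) * y ^ n) \<le> (\<Sum>n. inverse (fact n) * y ^ n)"
    by (rule sum_le_suminf) (use assms summable_exp in auto)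
  then have "y ^ k / fact k \<le> exp y"
    by (simp add: exp_def field_simps scaleR_conv_of_real)
  then show ?thesis
    by (simp add: exp_minus field_simps)
qed

text \<open>Near 0 the factor \<open>exp (- s / x)\<close> beats every power of \<open>x\<close>: it
  is at most a constant times \<open>x ^ k\<close>, and a Gamma integrand then dominates the weight
  for every real \<open>b\<close>.\<close>

lemma weight_integrable:
  assumes "s > 0"
  shows "set_integrable lborel {0<..} (weight b s)"
proof -
  \<comment> \<open>This makes the exponent \<open>z - 1 = b + k\<close> positive, so the Gamma
    integral at \<open>z\<close> converges.\<close>
  define k where "k = nat \<lceil>\<bar>b\<bar>\<rceil> + 1"
  have k: "b + real k > 0" unfolding k_def by linarith
  define z where "z = b + real k + 1"
  have "(\<lambda>t. t powr (z - 1) / exp t) integrable_on {0..}"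
    using Gamma_integral_real[of z] k unfolding z_def by (auto simp: integrable_on_def)
  then have "(\<lambda>t. t powr (z - 1) / exp t) absolutely_integrable_on {0..}"
    by (intro nonnegative_absolutely_integrable_1) auto
  then have "(\<lambda>t. t powr (z - 1) / exp t) absolutely_integrable_on {0<..}"
    by (rule set_integrable_subset) auto
  then have "set_integrable lborel {0<..} (\<lambda>t. t powr (z - 1) / exp t)"
    unfolding set_integrable_def by (simp add: integrable_completion)
  then have *: "set_integrable lborel {0<..} (\<lambda>t. (fact k / s ^ k) * (t powr (z - 1) / exp t))"
    by (intro set_integrable_mult_right) auto
  show ?thesis
  proof (rule set_integrable_bound[OF *])
    show "set_borel_measurable lborel {0<..} (weight b s)"
      unfolding set_borel_measurable_def by measurable
    show "AE x in lborel. x \<in> {0<..} \<longrightarrow>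
        norm (weight b s x) \<le> norm ((fact k / s ^ k) * (x powr (z - 1) / exp x))"
    proof (intro AE_I2 impI)
      fix x :: real assume "x \<in> {0<..}"
      then have x: "x > 0" by simp
      have "(s / x) ^ k * exp (- (s / x)) \<le> fact k"
        using exp_bound_power[of "s / x" k] x assms by simp
      then have e: "exp (- (s / x)) \<le> fact k / s ^ k * x ^ k"
        using x assms by (simp add: field_simps)
      have "weight b s x = x powr b * exp (- x) * exp (- (s / x))"
        by (simp add: weight_def exp_add [symmetric] mult.assoc)
      also have "\<dots> \<le> x powr b * exp (- x) * (fact k / s ^ k * x ^ k)"
        by (intro mult_left_mono e) auto
      also have "\<dots> = fact k / s ^ k * (x powr (z - 1) / exp x)"
        using x by (simp add: z_def powr_add powr_realpow exp_minus field_simps)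
      finally show "norm (weight b s x) \<le> norm (fact k / s ^ k * (x powr (z - 1) / exp x))"
        using weight_pos[OF x, of b s] assms by simp
    qed
  qed
qed

text \<open>Fundamental theorem of calculus for \<open>weight b s\<close>, which vanishes at both
  ends: at 0 through \<open>exp (- s / x)\<close>, at infinity through
  \<open>exp (- x)\<close>.\<close>

lemma weight_by_parts:
  assumes s: "s > 0"
  shows "s * wmom (b - 2) s + b * wmom (b - 1) s - wmom b s = 0"
proof -
  let ?f = "\<lambda>x. s * weight (b - 2) s x + b * weight (b - 1) s x - weight b s x"
  have int: "set_integrable lborel {0<..} ?f"
    using weight_integrable[OF s] by (intro set_integral_diff set_integral_add set_integrable_mult_right) auto
  have "(LBINT x=0..\<infinity>. ?f x) = 0 - 0"
  proof (rule interval_integral_FTC_integrable[where F = "weight b s"])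
    fix x :: real assume "0 < ereal x"
    then have x: "x > 0" by simp
    have "(weight b s has_real_derivative ?f x) (at x)"
      unfolding weight_def using x
      by (auto intro!: derivative_eq_intros simp: powr_diff field_simps power2_eq_square)
    then show "(weight b s has_vector_derivative ?f x) (at x)"
      by (simp add: has_real_derivative_iff_has_vector_derivative)
    show "isCont ?f x"
      unfolding weight_def using x by (intro continuous_intros) auto
  next
    show "set_integrable lborel (einterval 0 \<infinity>) ?f"
      using int by (simp add: zero_ereal_def)
    have "((\<lambda>x. weight b s x) \<longlongrightarrow> 0) (at_right 0)"
      unfolding weight_def using s by real_asymp
    then show "((weight b s \<circ> real_of_ereal) \<longlongrightarrow> 0) (at_right 0)"
      unfolding zero_ereal_def by (subst ereal_tendsto_simps) auto
    have "((\<lambda>x. weight b s x) \<longlongrightarrow> 0) at_top"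
      unfolding weight_def using s by real_asymp
    then show "((weight b s \<circ> real_of_ereal) \<longlongrightarrow> 0) (at_left \<infinity>)"
      by (subst ereal_tendsto_simps) auto
  qed simp
  then have "(LINT x:{0<..}|lborel. ?f x) = 0"
    by (simp add: interval_lebesgue_integral_0_infty)
  then show ?thesis
    using weight_integrable[OF s] unfolding wmom_def
    by (simp add: set_integral_diff set_integral_add)
qed

lemma exp_remainder_le:
  fixes y :: real
  shows "\<bar>exp y - 1 - y\<bar> \<le> y\<^sup>2 / 2 * exp \<bar>y\<bar>"
proof -
  obtain t where t: "\<bar>t\<bar> \<le> \<bar>y\<bar>" "exp y = (\<Sum>m<2. y ^ m / fact m) + exp t / fact 2 * y ^ 2"
    using Maclaurin_exp_le[of y 2] by blast
  then have "exp y - 1 - y = y\<^sup>2 / 2 * exp t"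
    by (simp add: numeral_2_eq_2)
  then have "\<bar>exp y - 1 - y\<bar> = y\<^sup>2 / 2 * exp t"
    by (simp only: abs_mult abs_divide) simp
  also have "\<dots> \<le> y\<^sup>2 / 2 * exp \<bar>y\<bar>"
    using t(1) by (intro mult_left_mono) auto
  finally show ?thesis .
qed

text \<open>Differentiation under the integral sign: \<open>exp (- s / x)\<close> yields a factor
  \<open>- 1 / x\<close>. An explicit quadratic error bound justifies it.\<close>

lemma wmom_has_derivative:
  assumes s: "s > 0"
  shows "(wmom b has_real_derivative - wmom (b - 1) s) (at s)"
proof -
  \<comment> \<open>The Taylor remainder is at most \<open>(h / x)^2 * exp (s / (2 * x))\<close>.
    The square lowers the exponent by 2, and the exponential turns \<open>s\<close> into
    \<open>s / 2\<close>.\<close>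
  define C where "C = wmom (b - 2) (s / 2)"
  have ineq: "\<bar>wmom b (s + h) - wmom b s + h * wmom (b - 1) s\<bar> \<le> C * h\<^sup>2" if h: "\<bar>h\<bar> \<le> s / 2" for h
  proof -
    let ?g = "\<lambda>x. weight b (s + h) x - weight b s x + h * weight (b - 1) s x"
    have sh: "s + h > 0" using h s by linarith
    have gi: "set_integrable lborel {0<..} ?g"
      using weight_integrable[OF s] weight_integrable[OF sh]
      by (intro set_integral_diff set_integral_add set_integrable_mult_right) auto
    have E: "wmom b (s + h) - wmom b s + h * wmom (b - 1) s = (LINT x:{0<..}|lborel. ?g x)"
      using weight_integrable[OF s] weight_integrable[OF sh] unfolding wmom_def
      by (simp add: set_integral_diff set_integral_add)
    have "\<bar>wmom b (s + h) - wmom b s + h * wmom (b - 1) s\<bar> \<le> (LINT x:{0<..}|lborel. \<bar>?g x\<bar>)"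
      unfolding E using set_integral_norm_bound[OF gi] by simp
    also have "\<dots> \<le> (LINT x:{0<..}|lborel. h\<^sup>2 * weight (b - 2) (s / 2) x)"
    proof (rule set_integral_mono[OF set_integrable_abs[OF gi]])
      show "set_integrable lborel {0<..} (\<lambda>x. h\<^sup>2 * weight (b - 2) (s / 2) x)"
        using weight_integrable[of "s / 2"] s by (intro set_integrable_mult_right) auto
      fix x :: real assume "x \<in> {0<..}"
      then have x: "x > 0" by simp
      have E: "?g x = weight b s x * (exp (- h / x) - 1 - (- h / x))"
      proof -
        have "weight b (s + h) x = weight b s x * exp (- h / x)"
          by (simp add: weight_def mult.assoc mult_exp_exp add_divide_distrib)
        moreover have "weight (b - 1) s x = weight b s x / x"
          using x by (simp add: weight_def powr_diff)
        ultimately show ?thesis by (simp add: algebra_simps)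
      qed
      have "\<bar>?g x\<bar> \<le> weight b s x * ((h / x)\<^sup>2 / 2 * exp \<bar>h / x\<bar>)"
        unfolding E using exp_remainder_le[of "- h / x"] weight_pos[OF x, of b s]
        by (simp add: abs_mult)
      also have "\<dots> \<le> weight b s x * ((h / x)\<^sup>2 * exp (s / 2 / x))"
        using weight_pos[OF x, of b s] h x
        by (intro mult_left_mono mult_mono) (simp_all add: field_simps)
      also have "\<dots> = h\<^sup>2 * weight (b - 2) (s / 2) x"
      proof -
        have "exp (- x - s / x) * exp (s / 2 / x) = exp (- x - s / 2 / x)"
          using x by (simp add: mult_exp_exp field_simps)
        then have "weight (b - 2) (s / 2) x = weight b s x * exp (s / 2 / x) / x\<^sup>2"
          using x by (simp add: weight_def powr_diff)
        then show ?thesis by (simp add: power_divide)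
      qed
      finally show "\<bar>?g x\<bar> \<le> h\<^sup>2 * weight (b - 2) (s / 2) x" .
    qed
    also have "\<dots> = C * h\<^sup>2"
      by (simp add: C_def wmom_def)
    finally show ?thesis .
  qed
  have "((\<lambda>h. (wmom b (s + h) - wmom b s) / h - (- wmom (b - 1) s)) \<longlongrightarrow> 0) (at 0)"
  proof (rule Lim_null_comparison)
    show "\<forall>\<^sub>F h in at 0. norm ((wmom b (s + h) - wmom b s) / h - (- wmom (b - 1) s)) \<le> C * \<bar>h\<bar>"
    proof (rule eventually_at_topological[THEN iffD2], intro exI conjI ballI impI)
      show "open {- (s / 2)<..<s / 2}" "0 \<in> {- (s / 2)<..<s / 2}" using s by auto
      fix h assume h: "h \<in> {- (s / 2)<..<s / 2}" "h \<noteq> 0"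
      have "norm ((wmom b (s + h) - wmom b s) / h - (- wmom (b - 1) s))
          = \<bar>(wmom b (s + h) - wmom b s + h * wmom (b - 1) s) / h\<bar>"
        using h by (simp add: field_simps)
      also have "\<dots> \<le> C * h\<^sup>2 / \<bar>h\<bar>"
        unfolding abs_divide by (intro divide_right_mono ineq) (use h in auto)
      also have "\<dots> = C * \<bar>h\<bar>"
        using h by (simp add: power2_eq_square abs_if)
      finally show "norm ((wmom b (s + h) - wmom b s) / h - (- wmom (b - 1) s)) \<le> C * \<bar>h\<bar>" .
    qed
    show "((\<lambda>h. C * \<bar>h\<bar>) \<longlongrightarrow> 0) (at 0)"
      by (auto intro!: tendsto_eq_intros)
  qed
  then show ?thesis
    unfolding DERIV_def by (rule LIM_zero_cancel)
qed

lemma moment_eq_wmom: "moment \<alpha> s m = wmom (\<alpha> + real m) s"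
  unfolding moment_def wmom_def
  by (intro set_lebesgue_integral_cong) (auto simp: weight_power[unfolded weight_def] weight_def)

subsection \<open>Integration of polynomials\<close>

hide_const (open) Module.smult

text \<open>With \<open>b = a\<close> this is \<open>\<langle>p\<rangle>\<close>, with \<open>b = a - 1\<close> it is \<open>\<langle>p / x\<rangle>\<close>.\<close>

definition lin :: "real \<Rightarrow> real \<Rightarrow> real poly \<Rightarrow> real" where
  "lin b s p = (\<Sum>i\<le>degree p. coeff p i * wmom (b + real i) s)"

lemma lin_eq_sum:
  assumes "degree p \<le> n"
  shows "lin b s p = (\<Sum>i\<le>n. coeff p i * wmom (b + real i) s)"
  unfolding lin_def by (rule sum.mono_neutral_left) (use assms in \<open>auto simp: coeff_eq_0\<close>)

lemma lin_0 [simp]: "lin b s 0 = 0"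
  by (simp add: lin_def)

lemma lin_add: "lin b s (p + q) = lin b s p + lin b s q"
proof -
  let ?n = "max (degree p) (degree q)"
  have "degree (p + q) \<le> ?n" by (rule degree_add_le_max)
  then show ?thesis
    by (simp add: lin_eq_sum[of _ ?n] sum.distrib algebra_simps)
qed

lemma lin_smult: "lin b s (smult c p) = c * lin b s p"
  by (simp add: lin_eq_sum[of "smult c p" "degree p"] degree_smult_le lin_def sum_distrib_left mult.assoc)

lemma lin_diff: "lin b s (p - q) = lin b s p - lin b s q"
  using lin_add[of b s p "smult (-1) q"] by (simp add: lin_smult del: smult_minus_left smult_1_left) simp

lemma lin_pCons_0: "lin b s (pCons 0 p) = lin (b + 1) s p"
  unfolding lin_eq_sum[OF degree_pCons_le] sum.atMost_Suc_shift
  by (simp add: lin_def add_ac)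

text \<open>The left side integrates the derivative of \<open>x * q\<close>, whose
  \<open>i\<close>-th coefficient is \<open>i + 1\<close> times that of \<open>q\<close>. Hence this
  is \<open>weight_by_parts\<close> with \<open>b = a + i + 1\<close>, summed over the
  monomials.\<close>

lemma lin_by_parts:
  assumes "s > 0"
  shows "lin a s (q + pCons 0 (pderiv q)) = lin (a + 1) s q - a * lin a s q - s * lin (a - 1) s q"
proof -
  have w: "(real i + 1) * wmom (a + real i) s =
      wmom (a + 1 + real i) s - a * wmom (a + real i) s - s * wmom (a - 1 + real i) s" for i
    using weight_by_parts[OF assms, of "a + real i + 1"] by (simp add: algebra_simps)
  have c: "coeff (q + pCons 0 (pderiv q)) i = (real i + 1) * coeff q i" for i
    by (cases i) (simp_all add: coeff_pderiv algebra_simps)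
  have "degree (q + pCons 0 (pderiv q)) \<le> degree q"
    by (rule degree_le) (simp only: c, simp add: coeff_eq_0)
  then have "lin a s (q + pCons 0 (pderiv q)) = (\<Sum>i\<le>degree q. coeff q i * ((real i + 1) * wmom (a + real i) s))"
    by (simp only: lin_eq_sum c) (simp add: algebra_simps)
  also have "\<dots> = lin (a + 1) s q - a * lin a s q - s * lin (a - 1) s q"
    unfolding w lin_def by (simp add: sum_subtractf sum_distrib_left sum.distrib algebra_simps)
  finally show ?thesis .
qed

lemma lin_integral:
  assumes "s > 0"
  shows "set_integrable lborel {0<..} (\<lambda>x. poly p x * weight b s x)"
    and "lin b s p = (LINT x:{0<..}|lborel. poly p x * weight b s x)"
proof -
  have eq: "poly p x * weight b s x = (\<Sum>i\<le>degree p. coeff p i * weight (b + real i) s x)"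
    if "x \<in> {0<..}" for x
    using that by (simp add: poly_altdef sum_distrib_right mult.assoc weight_power)
  have int: "set_integrable lborel {0<..} (\<lambda>x. coeff p i * weight (b + real i) s x)" for i
    using weight_integrable[OF assms] by (intro set_integrable_mult_right)
  have "set_integrable lborel {0<..} (\<lambda>x. \<Sum>i\<le>degree p. coeff p i * weight (b + real i) s x)"
    using int unfolding set_integrable_def scaleR_sum_right by (intro Bochner_Integration.integrable_sum)
  then show "set_integrable lborel {0<..} (\<lambda>x. poly p x * weight b s x)"
    by (subst set_integrable_cong[OF refl refl eq]) auto
  have "lin b s p = (\<Sum>i\<le>degree p. LINT x:{0<..}|lborel. coeff p i * weight (b + real i) s x)"
    unfolding lin_def wmom_def by simp
  also have "\<dots> = (LINT x:{0<..}|lborel. (\<Sum>i\<le>degree p. coeff p i * weight (b + real i) s x))"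
    using int unfolding set_lebesgue_integral_def set_integrable_def scaleR_sum_right
    by (intro Bochner_Integration.integral_sum[symmetric])
  also have "\<dots> = (LINT x:{0<..}|lborel. poly p x * weight b s x)"
    by (rule set_lebesgue_integral_cong) (use eq in auto)
  finally show "lin b s p = (LINT x:{0<..}|lborel. poly p x * weight b s x)" .
qed

text \<open>A nonnegative integrand with integral 0 vanishes almost everywhere, but here it is
  nonzero on \<open>{0<..}\<close> off the finitely many roots of \<open>p\<close>.\<close>

lemma lin_square_pos:
  assumes s: "s > 0" and p: "p \<noteq> 0"
  shows "lin b s (p * p) > 0"
proof -
  let ?f = "\<lambda>x. indicator {0<..} x *\<^sub>R (poly (p * p) x * weight b s x)"
  have int: "integrable lborel ?f"
    using lin_integral(1)[OF s, of "p * p" b] by (simp add: set_integrable_def)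
  have eq: "lin b s (p * p) = integral\<^sup>L lborel ?f"
    by (simp add: lin_integral(2)[OF s] set_lebesgue_integral_def)
  have nonneg: "?f x \<ge> 0" for x
    using weight_pos[of x b s] by (auto simp: indicator_def)
  have "integral\<^sup>L lborel ?f \<noteq> 0"
  proof
    assume "integral\<^sup>L lborel ?f = 0"
    then have "AE x in lborel. ?f x = 0"
      using integral_nonneg_eq_0_iff_AE[OF int] nonneg by auto
    moreover have "AE x in lborel. x \<notin> {x. poly p x = 0}"
      by (intro AE_not_in finite_imp_null_set_lborel poly_roots_finite p)
    ultimately have "AE x in lborel. x \<notin> {0<..<1::real}"
    proof eventually_elim
      fix x assume "?f x = 0" "x \<notin> {x. poly p x = 0}"
      then show "x \<notin> {0<..<1}"
        using weight_pos[of x b s] by (auto simp: indicator_def)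
    qed
    then have "emeasure lborel {0<..<1::real} = 0"
      by (intro null_setsD1) (simp add: AE_iff_null_sets)
    then show False by simp
  qed
  moreover have "integral\<^sup>L lborel ?f \<ge> 0"
    by (rule Bochner_Integration.integral_nonneg) (use nonneg in auto)
  ultimately show ?thesis
    using eq by linarith
qed

text \<open>Product rule: \<open>D\<close> is the derivative of the polynomial, and the moving
  weight contributes the term with exponent \<open>b - 1\<close>. The common degree bound
  \<open>n\<close> keeps the summation range fixed.\<close>

lemma lin_has_derivative:
  assumes s: "s > 0" and F: "\<And>t. degree (F t) \<le> n" "degree D \<le> n"
    and D: "\<And>i. ((\<lambda>t. coeff (F t) i) has_real_derivative coeff D i) (at s)"
  shows "((\<lambda>t. lin b t (F t)) has_real_derivative lin b s D - lin (b - 1) s (F s)) (at s)"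
proof -
  have "((\<lambda>t. \<Sum>i\<le>n. coeff (F t) i * wmom (b + real i) t) has_real_derivative
      (\<Sum>i\<le>n. coeff D i * wmom (b + real i) s + (- wmom (b + real i - 1) s) * coeff (F s) i)) (at s)"
    by (intro DERIV_sum DERIV_mult D wmom_has_derivative s)
  moreover have "(\<Sum>i\<le>n. coeff D i * wmom (b + real i) s + (- wmom (b + real i - 1) s) * coeff (F s) i)
      = lin b s D - lin (b - 1) s (F s)"
    unfolding lin_eq_sum[OF F(1)] lin_eq_sum[OF F(2)] sum_subtractf[symmetric]
    by (intro sum.cong refl) (simp add: algebra_simps)
  ultimately show ?thesis
    by (simp only: lin_eq_sum[OF F(1)])
qed

lemma lin_differentiable:
  assumes s: "s > 0" and F: "\<And>t. degree (F t) \<le> n"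
    and D: "\<And>i. (\<lambda>t. coeff (F t) i) differentiable (at s)"
  shows "(\<lambda>t. lin b t (F t)) differentiable (at s)"
  unfolding lin_eq_sum[OF F]
  by (intro differentiable_sum finite_atMost differentiable_mult D ballI)
     (use wmom_has_derivative[OF s] in \<open>auto simp: real_differentiable_def\<close>)

subsection \<open>Orthogonal polynomials\<close>

text \<open>Three-term recurrence instead of Gram-Schmidt. The coefficients are spelled out through
  \<open>lin\<close>, since their names below depend on \<open>ortho\<close> itself.\<close>

fun ortho :: "real \<Rightarrow> real \<Rightarrow> nat \<Rightarrow> real poly" where
  "ortho a s 0 = 1"
| "ortho a s (Suc 0) = pCons 0 1 - smult (lin (a + 1) s 1 / lin a s 1) 1"
| "ortho a s (Suc (Suc n)) = (let p = ortho a s (Suc n); q = ortho a s n in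
     pCons 0 p - smult (lin (a + 1) s (p * p) / lin a s (p * p)) p
       - smult (lin a s (p * p) / lin a s (q * q)) q)"

definition sqnorm :: "real \<Rightarrow> real \<Rightarrow> nat \<Rightarrow> real" where
  "sqnorm a s n = lin a s (ortho a s n * ortho a s n)"

definition diag_coeff :: "real \<Rightarrow> real \<Rightarrow> nat \<Rightarrow> real" where
  "diag_coeff a s n = lin (a + 1) s (ortho a s n * ortho a s n) / sqnorm a s n"

text \<open>The value 0 at \<open>n = 0\<close> cancels the spurious term
  \<open>ortho a s (0 - 1)\<close>, so one recurrence covers all \<open>n\<close>.\<close>

definition off_coeff :: "real \<Rightarrow> real \<Rightarrow> nat \<Rightarrow> real" where
  "off_coeff a s n = (if n = 0 then 0 else sqnorm a s n / sqnorm a s (n - 1))"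

lemma ortho_Suc:
  "ortho a s (Suc n) = pCons 0 (ortho a s n) - smult (diag_coeff a s n) (ortho a s n)
     - smult (off_coeff a s n) (ortho a s (n - 1))"
  by (cases n) (simp_all add: diag_coeff_def off_coeff_def sqnorm_def Let_def)

lemma ortho_coeff: "coeff (ortho a s n) n = 1 \<and> (\<forall>i>n. coeff (ortho a s n) i = 0)"
proof (induction n rule: less_induct)
  case (less n)
  show ?case
  proof (cases n)
    case 0
    then show ?thesis by (auto simp: coeff_1)
  next
    case (Suc m)
    have "coeff (ortho a s m) m = 1" "\<forall>i>m. coeff (ortho a s m) i = 0"
      using less[of m] Suc by auto
    moreover have "\<forall>i>m. coeff (ortho a s (m - 1)) i = 0"
      using less[of "m - 1"] Suc by auto
    ultimately show ?thesis
      unfolding Suc ortho_Suc by (auto simp: coeff_pCons split: nat.splits)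
  qed
qed

lemma degree_ortho [simp]: "degree (ortho a s n) = n"
  using ortho_coeff[of a s n] by (metis degree_le le_degree order_antisym zero_neq_one)

lemma coeff_ortho_self [simp]: "coeff (ortho a s n) n = 1"
  using ortho_coeff by blast

lemma coeff_ortho_gt [simp]: "n < i \<Longrightarrow> coeff (ortho a s n) i = 0"
  using ortho_coeff by blast

lemma ortho_nonzero [simp]: "ortho a s n \<noteq> 0"
  by (metis coeff_0 coeff_ortho_self zero_neq_one)

lemma sqnorm_pos: "s > 0 \<Longrightarrow> sqnorm a s n > 0"
  by (simp add: sqnorm_def lin_square_pos)

text \<open>Expand \<open>P n\<close> with \<open>n = Suc m\<close> by the recurrence. For
  \<open>k = m\<close> the diagonal coefficient cancels the remaining terms; for
  \<open>k < m\<close> the factor \<open>x\<close> moves onto \<open>P k\<close>, which leaves a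
  contribution only if \<open>Suc k = m\<close>, and the off-diagonal coefficient cancels
  it.\<close>

lemma ortho_pairwise:
  assumes s: "s > 0"
  shows "k < n \<Longrightarrow> lin a s (ortho a s n * ortho a s k) = 0"
proof (induction n arbitrary: k rule: less_induct)
  case (less n)
  let ?P = "ortho a s"
  obtain m where n: "n = Suc m" using less.prems by (cases n) auto
  have IH: "lin a s (?P j * ?P i) = 0" if "i < j" "j \<le> m" for i j
    using less.IH[of j i] that n by simp
  have *: "lin a s (?P n * ?P k) = lin (a + 1) s (?P m * ?P k)
      - diag_coeff a s m * lin a s (?P m * ?P k) - off_coeff a s m * lin a s (?P (m - 1) * ?P k)"
    unfolding n ortho_Suc by (simp add: left_diff_distrib lin_diff lin_smult lin_pCons_0)
  show ?case
  proof (cases "k = m")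
    case True
    have "off_coeff a s m * lin a s (?P (m - 1) * ?P m) = 0"
      using IH[of "m - 1" m] by (cases m) (auto simp: off_coeff_def mult.commute)
    then show ?thesis
      using * True sqnorm_pos[OF s, of a m] by (simp add: diag_coeff_def sqnorm_def)
  next
    case False
    then have k: "k < m" using less.prems n by simp
    \<comment> \<open>The recurrence at \<open>k\<close>, read as an expansion of
      \<open>x * P k\<close>.\<close>
    have "pCons 0 (?P k) = ?P (Suc k) + smult (diag_coeff a s k) (?P k) + smult (off_coeff a s k) (?P (k - 1))"
      unfolding ortho_Suc by simp
    then have "lin (a + 1) s (?P m * ?P k) = lin a s (?P m * (?P (Suc k)
        + smult (diag_coeff a s k) (?P k) + smult (off_coeff a s k) (?P (k - 1))))"
      by (metis lin_pCons_0 mult_pCons_right smult_0_left add_0)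
    also have "\<dots> = lin a s (?P m * ?P (Suc k))"
      using IH[of k m] IH[of "k - 1" m] k by (simp add: ring_distribs lin_add lin_smult)
    finally have 1: "lin (a + 1) s (?P m * ?P k) = lin a s (?P m * ?P (Suc k))" .
    have "lin a s (?P m * ?P (Suc k)) = off_coeff a s m * lin a s (?P (m - 1) * ?P k)"
    proof (cases "Suc k = m")
      case True
      then show ?thesis
        using sqnorm_pos[OF s, of a k] by (auto simp: off_coeff_def sqnorm_def)
    next
      case False
      then show ?thesis
        using IH[of "Suc k" m] IH[of k "m - 1"] k by simp
    qed
    then show ?thesis
      using * 1 IH[of k m] k by simp
  qed
qed

text \<open>Peel off the top coefficient of \<open>q\<close> with a multiple of the monic
  \<open>P m\<close>. Bounding the degree through coefficients includes the case
  \<open>n = 0\<close>, where \<open>q = 0\<close>.\<close>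

lemma ortho_orthogonal:
  assumes s: "s > 0" and q: "\<And>i. i \<ge> n \<Longrightarrow> coeff q i = 0"
  shows "lin a s (ortho a s n * q) = 0"
proof -
  have "\<forall>q. (\<forall>i\<ge>m. coeff q i = 0) \<longrightarrow> lin a s (ortho a s n * q) = 0" if "m \<le> n" for m
    using that
  proof (induction m)
    case 0
    have "q = 0" if "\<forall>i\<ge>0. coeff q i = 0" for q :: "real poly"
      using that by (simp add: poly_eq_iff)
    then show ?case by force
  next
    case (Suc m)
    show ?case
    proof (intro allI impI)
      fix q :: "real poly"
      assume q: "\<forall>i\<ge>Suc m. coeff q i = 0"
      let ?r = "q - smult (coeff q m) (ortho a s m)"
      have "coeff ?r i = 0" if "i \<ge> m" for i
        using that q by (cases "i = m") auto
      then have "lin a s (ortho a s n * ?r) = 0"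
        using Suc.IH Suc.prems Suc_leD by blast
      moreover have "lin a s (ortho a s n * ortho a s m) = 0"
        using ortho_pairwise[OF s] Suc.prems by simp
      ultimately show "lin a s (ortho a s n * q) = 0"
        by (simp add: right_diff_distrib lin_diff lin_smult)
    qed
  qed
  from this[of n] q show ?thesis by blast
qed

lemma ortho_top:
  assumes s: "s > 0" and q: "\<And>i. i > n \<Longrightarrow> coeff q i = 0"
  shows "lin a s (ortho a s n * q) = coeff q n * sqnorm a s n"
proof -
  let ?r = "q - smult (coeff q n) (ortho a s n)"
  have "coeff ?r i = 0" if "i \<ge> n" for i
    using that q by (cases "i = n") auto
  then have "lin a s (ortho a s n * ?r) = 0"
    by (rule ortho_orthogonal[OF s])
  then show ?thesis
    by (simp add: right_diff_distrib lin_diff lin_smult sqnorm_def)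
qed

text \<open>Split \<open>q = q(0) + x * r\<close>: the factor \<open>x\<close> cancels
  \<open>1 / x\<close>, and \<open>r\<close> is of too low degree to contribute.\<close>

lemma ortho_inverse_weight:
  assumes s: "s > 0" and q: "\<And>i. i > n \<Longrightarrow> coeff q i = 0"
  shows "lin (a - 1) s (ortho a s n * q) = poly q 0 * lin (a - 1) s (ortho a s n)"
proof -
  obtain c r where qr: "q = pCons c r" by (cases q)
  have "coeff r i = 0" if "i \<ge> n" for i
    using q[of "Suc i"] that qr by simp
  then have "lin a s (ortho a s n * r) = 0"
    by (rule ortho_orthogonal[OF s])
  then show ?thesis
    using lin_pCons_0[of "a - 1" s "ortho a s n * r"] by (simp add: qr lin_add lin_smult)
qed

section \<open>Values at 0, means against \<open>1 / x\<close>, and their Casoratian\<close>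

definition val0 :: "real \<Rightarrow> real \<Rightarrow> nat \<Rightarrow> real" where
  "val0 a s n = poly (ortho a s n) 0"

text \<open>The function of the second kind (Cauchy transform) of \<open>P n\<close> at 0. It
  therefore obeys the recurrence of \<open>val0\<close>, up to a source term at
  \<open>n = 0\<close>.\<close>

definition inv_mean :: "real \<Rightarrow> real \<Rightarrow> nat \<Rightarrow> real" where
  "inv_mean a s n = lin (a - 1) s (ortho a s n)"

lemma lin_ortho_ortho_inverse:
  assumes "s > 0" "k \<le> n"
  shows "lin (a - 1) s (ortho a s n * ortho a s k) = val0 a s k * inv_mean a s n"
  using ortho_inverse_weight[OF assms(1), of n "ortho a s k" a] assms(2)
  by (simp add: val0_def inv_mean_def)

lemma val0_mult_inv_mean_pos:
  "s > 0 \<Longrightarrow> val0 a s n * inv_mean a s n > 0"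
  by (metis lin_ortho_ortho_inverse lin_square_pos order_refl ortho_nonzero)

lemma val0_Suc:
  "val0 a s (Suc n) = - diag_coeff a s n * val0 a s n - off_coeff a s n * val0 a s (n - 1)"
  by (simp add: val0_def ortho_Suc)

lemma inv_mean_Suc:
  assumes "s > 0"
  shows "inv_mean a s (Suc n) = (if n = 0 then sqnorm a s 0 else 0)
     - diag_coeff a s n * inv_mean a s n - off_coeff a s n * inv_mean a s (n - 1)"
proof -
  have "lin a s (ortho a s n) = (if n = 0 then sqnorm a s 0 else 0)"
    using ortho_top[OF assms, of n 1 a] by (cases n) (auto simp: coeff_1)
  then show ?thesis
    using lin_pCons_0[of "a - 1" s "ortho a s n"]
    by (simp add: inv_mean_def ortho_Suc lin_diff lin_smult)
qed

text \<open>For two solutions of one three-term recurrence, each step multiplies the Casoratian by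
  the off-diagonal coefficient, a ratio of consecutive \<open>sqnorm\<close>s. The source term gives
  the initial value.\<close>

lemma casoratian:
  assumes s: "s > 0"
  shows "val0 a s n * inv_mean a s (Suc n) - val0 a s (Suc n) * inv_mean a s n = sqnorm a s n"
proof (induction n)
  case 0
  show ?case
    unfolding val0_Suc inv_mean_Suc[OF s] by (simp add: val0_def off_coeff_def)
next
  case (Suc n)
  have "val0 a s (Suc n) * inv_mean a s (Suc (Suc n)) - val0 a s (Suc (Suc n)) * inv_mean a s (Suc n)
      = off_coeff a s (Suc n) * (val0 a s n * inv_mean a s (Suc n) - val0 a s (Suc n) * inv_mean a s n)"
    unfolding val0_Suc[of a s "Suc n"] inv_mean_Suc[OF s, of a "Suc n"] by (simp add: algebra_simps)
  also have "\<dots> = sqnorm a s (Suc n)"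
    unfolding Suc using sqnorm_pos[OF s, of a n] by (simp add: off_coeff_def)
  finally show ?case .
qed

lemma coeff_ortho_subleading: "coeff (ortho a s (Suc n)) n = - (\<Sum>j\<le>n. diag_coeff a s j)"
proof (induction n)
  case 0
  show ?case unfolding ortho_Suc by (simp add: off_coeff_def)
next
  case (Suc n)
  then show ?case unfolding ortho_Suc[of a s "Suc n"] by simp
qed

subsection \<open>The ladder quantities\<close>

text \<open>By orthogonality, \<open>s / h n\<close> times the integral of
  \<open>(P n)^2 / x\<close>; likewise \<open>ladder_b\<close> is \<open>s / h (n-1)\<close> times
  that of \<open>P n * P (n-1) / x\<close> for \<open>n > 0\<close>.\<close>

definition ladder_a :: "real \<Rightarrow> real \<Rightarrow> nat \<Rightarrow> real" where
  "ladder_a a s n = s * (val0 a s n * inv_mean a s n) / sqnorm a s n"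

definition ladder_b :: "real \<Rightarrow> real \<Rightarrow> nat \<Rightarrow> real" where
  "ladder_b a s n = (if n = 0 then 0 else s * (val0 a s (n - 1) * inv_mean a s n) / sqnorm a s (n - 1))"

lemma ladder_a_pos: "s > 0 \<Longrightarrow> ladder_a a s n > 0"
  unfolding ladder_a_def by (intro divide_pos_pos mult_pos_pos[of s] val0_mult_inv_mean_pos sqnorm_pos)

text \<open>Integration by parts with \<open>q = (P n)^2\<close>. As \<open>x * P n'\<close> has
  leading coefficient \<open>n\<close>, the term \<open>x * q'\<close> contributes
  \<open>2 * n * h n\<close>.\<close>

lemma diag_coeff_eq:
  assumes s: "s > 0"
  shows "diag_coeff a s n = 2 * real n + 1 + a + ladder_a a s n"
proof -
  let ?P = "ortho a s n"
  have "lin a s (?P * pCons 0 (pderiv ?P)) = real n * sqnorm a s n"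
    using ortho_top[OF s, of n "pCons 0 (pderiv ?P)" a]
    by (cases n) (auto simp: coeff_pCons coeff_pderiv split: nat.splits)
  moreover have "pCons 0 (pderiv (?P * ?P)) = ?P * pCons 0 (pderiv ?P) + ?P * pCons 0 (pderiv ?P)"
    unfolding pderiv_mult by simp
  ultimately have "lin a s (?P * ?P + pCons 0 (pderiv (?P * ?P))) = (2 * real n + 1) * sqnorm a s n"
    by (simp only: lin_add sqnorm_def[symmetric]) (simp add: algebra_simps)
  moreover have "lin (a + 1) s (?P * ?P) = diag_coeff a s n * sqnorm a s n"
    using sqnorm_pos[OF s, of a n] by (simp add: diag_coeff_def)
  ultimately show ?thesis
    using lin_by_parts[OF s, of a "?P * ?P"] sqnorm_pos[OF s, of a n]
      lin_ortho_ortho_inverse[OF s, of n n a]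
    by (simp add: ladder_a_def sqnorm_def[symmetric] field_simps)
qed

text \<open>Integration by parts with \<open>q = P (m+1) * P m\<close>. The degree of
  \<open>x * P m'\<close> is too low to matter, and \<open>x * P (m+1)'\<close> acts through its
  part of degree \<open>m\<close> after removal of \<open>(m+1) * P (m+1)\<close>.\<close>

lemma off_coeff_eq:
  assumes s: "s > 0"
  shows "off_coeff a s (Suc m) = ladder_b a s (Suc m) - coeff (ortho a s (Suc m)) m"
proof -
  let ?P = "ortho a s (Suc m)" and ?Q = "ortho a s m"
  let ?c = "coeff ?P m" and ?R = "pCons 0 (pderiv ?P) - smult (real (Suc m)) ?P"
  have "lin a s (?P * pCons 0 (pderiv ?Q)) = 0"
    by (rule ortho_orthogonal[OF s]) (auto simp: coeff_pCons coeff_pderiv split: nat.splits)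
  moreover have "lin a s (?Q * pCons 0 (pderiv ?P)) = - ?c * sqnorm a s m"
  proof -
    have cR: "coeff ?R i = (real i - real (Suc m)) * coeff ?P i" for i
      by (cases i) (simp_all add: coeff_pderiv algebra_simps)
    have "coeff ?R i = 0" if "i > m" for i
      unfolding cR using that by (cases "i = Suc m") auto
    then have "lin a s (?Q * ?R) = coeff ?R m * sqnorm a s m"
      by (rule ortho_top[OF s])
    moreover have "lin a s (?Q * ?P) = 0"
      using ortho_pairwise[OF s, of m "Suc m" a] by (simp add: mult.commute)
    ultimately show ?thesis
      unfolding cR by (simp add: right_diff_distrib lin_diff lin_smult)
  qed
  moreover have "pCons 0 (pderiv (?P * ?Q)) = ?P * pCons 0 (pderiv ?Q) + ?Q * pCons 0 (pderiv ?P)"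
    by (simp add: pderiv_mult)
  moreover have "lin a s (?P * ?Q) = 0"
    using ortho_pairwise[OF s, of m "Suc m" a] by simp
  ultimately have "lin a s (?P * ?Q + pCons 0 (pderiv (?P * ?Q))) = - ?c * sqnorm a s m"
    by (simp only: lin_add add_0)
  moreover have "lin (a + 1) s (?P * ?Q) = sqnorm a s (Suc m)"
    using ortho_top[OF s, of "Suc m" "pCons 0 ?Q" a] lin_pCons_0[of a s "?P * ?Q"]
    by (auto simp: coeff_pCons split: nat.splits)
  moreover have "lin (a - 1) s (?P * ?Q) = val0 a s m * inv_mean a s (Suc m)"
    by (simp add: lin_ortho_ortho_inverse[OF s])
  ultimately show ?thesis
    using lin_by_parts[OF s, of a "?P * ?Q"] \<open>lin a s (?P * ?Q) = 0\<close> sqnorm_pos[OF s, of a m]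
    by (simp add: ladder_b_def off_coeff_def field_simps)
qed

text \<open>The Casoratian expresses \<open>v n * u (n+1)\<close> through
  \<open>v (n+1) * u n\<close>; expanding \<open>v (n+1)\<close> by the recurrence produces
  \<open>A n\<close> and \<open>B n\<close>.\<close>

lemma ladder_b_add:
  assumes s: "s > 0"
  shows "ladder_b a s (Suc n) + ladder_b a s n = s - diag_coeff a s n * ladder_a a s n"
proof -
  have h: "sqnorm a s n > 0" for n using sqnorm_pos[OF s] .
  have V: "val0 a s n * inv_mean a s (Suc n) = sqnorm a s n
      - (diag_coeff a s n * val0 a s n + off_coeff a s n * val0 a s (n - 1)) * inv_mean a s n"
    using casoratian[OF s, of a n] val0_Suc[of a s n] by (simp add: algebra_simps)
  have L: "ladder_b a s (Suc n) = s * (sqnorm a s n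
      - (diag_coeff a s n * val0 a s n + off_coeff a s n * val0 a s (n - 1)) * inv_mean a s n) / sqnorm a s n"
    by (simp add: ladder_b_def V)
  show ?thesis
    unfolding L using h[of n] h[of "n - 1"]
    by (cases "n = 0") (simp_all add: ladder_b_def ladder_a_def off_coeff_def field_simps)
qed

text \<open>By the Casoratian, subtracting \<open>s\<close> from \<open>B n\<close> swaps the
  indices of \<open>v\<close> and \<open>u\<close>; the four factors then regroup into
  \<open>A n * A (n-1)\<close>.\<close>

lemma ladder_b_mult:
  assumes s: "s > 0"
  shows "off_coeff a s n * ladder_a a s n * ladder_a a s (n - 1) = ladder_b a s n * (ladder_b a s n - s)"
proof (cases n)
  case 0
  then show ?thesis by (simp add: off_coeff_def ladder_b_def)
next
  case (Suc m)
  have h: "sqnorm a s n > 0" for n using sqnorm_pos[OF s] .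
  have "ladder_b a s n - s = s * (val0 a s m * inv_mean a s n - sqnorm a s m) / sqnorm a s m"
    using h[of m] by (simp add: Suc ladder_b_def field_simps)
  also have "val0 a s m * inv_mean a s n - sqnorm a s m = val0 a s n * inv_mean a s m"
    using casoratian[OF s, of a m] Suc by simp
  finally have *: "ladder_b a s n - s = s * (val0 a s n * inv_mean a s m) / sqnorm a s m" .
  show ?thesis
    unfolding * using h[of m] h[of n] by (simp add: Suc ladder_b_def off_coeff_def ladder_a_def)
qed

text \<open>Consecutive instances of \<open>off_coeff_eq\<close> differ by a difference of
  subleading coefficients, which is one diagonal coefficient.\<close>

lemma off_coeff_Suc_diff:
  assumes s: "s > 0"
  shows "off_coeff a s (Suc n) - off_coeff a s n = diag_coeff a s n + ladder_b a s (Suc n) - ladder_b a s n"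
proof (cases n)
  case 0
  then show ?thesis
    using off_coeff_eq[OF s, of a 0] coeff_ortho_subleading[of a s 0]
    by (simp add: ladder_b_def off_coeff_def)
next
  case (Suc m)
  then show ?thesis
    using off_coeff_eq[OF s, of a "Suc m"] off_coeff_eq[OF s, of a m]
      coeff_ortho_subleading[of a s m] coeff_ortho_subleading[of a s "Suc m"]
    by simp
qed

lemma ladder_sum_rule:
  assumes s: "s > 0"
  shows "off_coeff a s n * (ladder_a a s n + ladder_a a s (n - 1)) = real n * s - (2 * real n + a) * ladder_b a s n"
proof (induction n)
  case 0
  show ?case by (simp add: off_coeff_def ladder_b_def)
next
  case (Suc n)
  let ?A = "ladder_a a s" and ?b = "ladder_b a s" and ?\<alpha> = "diag_coeff a s n" and ?\<beta> = "off_coeff a s"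
  note m = ladder_b_mult[OF s, of a n] ladder_b_mult[OF s, of a "Suc n"]
  have S: "?b (Suc n) = s - ?\<alpha> * ?A n - ?b n"
    using ladder_b_add[OF s, of a n] by simp
  have B: "?\<beta> (Suc n) = ?\<beta> n + ?\<alpha> + ?b (Suc n) - ?b n"
    using off_coeff_Suc_diff[OF s, of a n] by simp
  have D: "?\<alpha> = 2 * real n + 1 + a + ?A n"
    by (rule diag_coeff_eq[OF s])
  \<comment> \<open>Multiplying by \<open>A n\<close> lets \<open>ladder_b_mult\<close> remove
    \<open>A (n-1)\<close>; the next step removes \<open>A (n+1)\<close> in the same way, so both
    instances involve only data at \<open>n\<close> and \<open>n+1\<close> linked by
    \<open>S\<close>, \<open>B\<close> and \<open>D\<close>.\<close>
  have IH: "?\<beta> n * (?A n)\<^sup>2 + ?b n * (?b n - s) = (real n * s - (2 * real n + a) * ?b n) * ?A n"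
    unfolding Suc[symmetric] m(1)[symmetric] by (simp add: algebra_simps power2_eq_square)
  have "?A n * (?\<beta> (Suc n) * (?A (Suc n) + ?A n)) = ?\<beta> (Suc n) * (?A n)\<^sup>2 + ?b (Suc n) * (?b (Suc n) - s)"
    using m(2) by (simp add: algebra_simps power2_eq_square)
  also have "\<dots> = (real n * s - (2 * real n + a) * ?b n) * ?A n
      + (?\<alpha> + ?b (Suc n) - ?b n) * (?A n)\<^sup>2 + ?b (Suc n) * (?b (Suc n) - s) - ?b n * (?b n - s)"
    unfolding B IH[symmetric] by (simp add: algebra_simps)
  also have "\<dots> = ?A n * (real (Suc n) * s - (2 * real (Suc n) + a) * ?b (Suc n))"
    unfolding S D by (simp add: algebra_simps power2_eq_square)
  finally show ?case
    using ladder_a_pos[OF s, of a n] by simp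
qed

subsection \<open>Dependence on s\<close>

text \<open>The recurrence builds the coefficients from moments by rational operations with nonzero
  denominators. Only existence is needed; orthogonality supplies the values later.\<close>

lemma ortho_coeff_differentiable:
  assumes s: "s > 0"
  shows "(\<lambda>t. coeff (ortho a t n) i) differentiable (at s)"
proof (induction n arbitrary: i rule: less_induct)
  case (less n)
  show ?case
  proof (cases n)
    case 0
    then show ?thesis by simp
  next
    case (Suc m)
    have D: "(\<lambda>t. coeff (ortho a t k) i) differentiable (at s)" if "k \<le> m" for k i
      using less that Suc by simp
    have L: "(\<lambda>t. lin b t (ortho a t k * ortho a t k)) differentiable (at s)" if "k \<le> m" for b k
    proof (rule lin_differentiable[OF s])
      show "degree (ortho a t k * ortho a t k) \<le> k + k" for t
        using degree_mult_le[of "ortho a t k" "ortho a t k"] by simp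
      show "(\<lambda>t. coeff (ortho a t k * ortho a t k) i) differentiable (at s)" for i
        unfolding coeff_mult by (intro differentiable_sum differentiable_mult D that finite_atMost ballI)
    qed
    have nz: "sqnorm a s k \<noteq> 0" for k
      using sqnorm_pos[OF s, of a k] by simp
    have h: "(\<lambda>t. sqnorm a t k) differentiable (at s)" if "k \<le> m" for k
      unfolding sqnorm_def by (rule L[OF that])
    have dc: "(\<lambda>t. diag_coeff a t m) differentiable (at s)"
      unfolding diag_coeff_def by (intro differentiable_divide L h nz) simp_all
    have oc: "(\<lambda>t. off_coeff a t m) differentiable (at s)"
      unfolding off_coeff_def by (cases "m = 0") (auto intro!: differentiable_divide h nz)
    have pc: "(\<lambda>t. coeff (pCons 0 (ortho a t m)) i) differentiable (at s)"
      by (cases i) (auto intro: D)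
    show ?thesis
      unfolding Suc ortho_Suc coeff_diff coeff_smult
      by (intro differentiable_diff differentiable_mult pc dc oc D) simp_all
  qed
qed

lemma lin_ortho_mult_has_derivative:
  assumes s: "s > 0"
  obtains D where "\<And>i. i \<ge> n \<Longrightarrow> coeff D i = 0"
    and "\<And>i. ((\<lambda>t. coeff (ortho a t n) i) has_real_derivative coeff D i) (at s)"
    and "\<And>q. ((\<lambda>t. lin a t (ortho a t n * q)) has_real_derivative
           lin a s (D * q) - lin (a - 1) s (ortho a s n * q)) (at s)"
proof -
  \<comment> \<open>The derivative of \<open>P n\<close> in \<open>s\<close>; its degree stays below
    \<open>n\<close> because the leading coefficient is constantly 1.\<close>
  define D where "D = (\<Sum>k<n. monom (deriv (\<lambda>t. coeff (ortho a t n) k) s) k)"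
  have cD: "coeff D i = (if i < n then deriv (\<lambda>t. coeff (ortho a t n) i) s else 0)" for i
    unfolding D_def by (simp add: coeff_sum)
  have 2: "((\<lambda>t. coeff (ortho a t n) i) has_real_derivative coeff D i) (at s)" for i
  proof (cases "i < n")
    case True
    then show ?thesis
      using ortho_coeff_differentiable[OF s, of a n i] by (simp add: cD DERIV_deriv_iff_real_differentiable)
  next
    case False
    then have "(\<lambda>t. coeff (ortho a t n) i) = (\<lambda>t. if i = n then 1 else 0)"
      by (auto simp: not_less)
    then show ?thesis using False by (simp add: cD)
  qed
  have "degree D \<le> n"
    by (rule degree_le) (simp add: cD)
  have 3: "((\<lambda>t. lin a t (ortho a t n * q)) has_real_derivative
      lin a s (D * q) - lin (a - 1) s (ortho a s n * q)) (at s)" for q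
  proof (rule lin_has_derivative[OF s])
    show "degree (ortho a t n * q) \<le> n + degree q" for t
      using degree_mult_le[of "ortho a t n" q] by simp
    show "degree (D * q) \<le> n + degree q"
      using degree_mult_le[of D q] \<open>degree D \<le> n\<close> by simp
    show "((\<lambda>t. coeff (ortho a t n * q) i) has_real_derivative coeff (D * q) i) (at s)" for i
      unfolding coeff_mult by (intro DERIV_sum DERIV_cmult_right 2)
  qed
  show ?thesis
    by (rule that[OF _ 2 3]) (simp add: cD)
qed

text \<open>The derivative of \<open>P n\<close> is orthogonal to \<open>P n\<close>, so only the
  derivative of the weight survives: minus the integral of \<open>(P n)^2 / x\<close>.\<close>

lemma sqnorm_has_derivative:
  assumes s: "s > 0"
  shows "((\<lambda>t. sqnorm a t n) has_real_derivative - (val0 a s n * inv_mean a s n)) (at s)"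
proof -
  let ?q = "ortho a s n"
  \<comment> \<open>Freezing the second factor at the base point avoids differentiating a product of two moving polynomials.\<close>
  obtain D where D: "\<And>i. i \<ge> n \<Longrightarrow> coeff D i = 0"
    "\<And>q. ((\<lambda>t. lin a t (ortho a t n * q)) has_real_derivative
           lin a s (D * q) - lin (a - 1) s (ortho a s n * q)) (at s)"
    using lin_ortho_mult_has_derivative[OF s, of n a] by metis
  have "lin a s (D * ?q) = 0"
    using ortho_orthogonal[OF s D(1), where a = a] by (simp add: mult.commute)
  then have "((\<lambda>t. lin a t (ortho a t n * ?q)) has_real_derivative - (val0 a s n * inv_mean a s n)) (at s)"
    using D(2)[of ?q] lin_ortho_ortho_inverse[OF s, of n n a] by simp
  then show ?thesis
  proof (rule has_field_derivative_transform_within_open[where S = "{0<..}"])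
    fix t :: real assume "t \<in> {0<..}"
    then show "lin a t (ortho a t n * ?q) = sqnorm a t n"
      using ortho_top[of t n ?q a] by simp
  qed (use s in auto)
qed

lemma coeff_ortho_has_derivative:
  assumes s: "s > 0"
  shows "((\<lambda>t. coeff (ortho a t (Suc m)) m) has_real_derivative ladder_b a s (Suc m) / s) (at s)"
proof -
  let ?q = "ortho a s m"
  obtain D where D: "\<And>i. i \<ge> Suc m \<Longrightarrow> coeff D i = 0"
    "\<And>i. ((\<lambda>t. coeff (ortho a t (Suc m)) i) has_real_derivative coeff D i) (at s)"
    "\<And>q. ((\<lambda>t. lin a t (ortho a t (Suc m) * q)) has_real_derivative
           lin a s (D * q) - lin (a - 1) s (ortho a s (Suc m) * q)) (at s)"
    using lin_ortho_mult_has_derivative[OF s, of "Suc m" a] by blast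
  have "((\<lambda>t. 0) has_real_derivative
      lin a s (D * ?q) - lin (a - 1) s (ortho a s (Suc m) * ?q)) (at s)"
    using D(3)[of ?q]
  proof (rule has_field_derivative_transform_within_open[where S = "{0<..}"])
    fix t :: real assume "t \<in> {0<..}"
    then show "lin a t (ortho a t (Suc m) * ?q) = 0"
      by (intro ortho_orthogonal) auto
  qed (use s in auto)
  then have "lin a s (D * ?q) = lin (a - 1) s (ortho a s (Suc m) * ?q)"
    using DERIV_unique[OF _ DERIV_const] by fastforce
  moreover have "lin a s (D * ?q) = coeff D m * sqnorm a s m"
    using ortho_top[OF s, of m D a] D(1) by (simp add: mult.commute)
  moreover have "lin (a - 1) s (ortho a s (Suc m) * ?q) = val0 a s m * inv_mean a s (Suc m)"
    by (simp add: lin_ortho_ortho_inverse[OF s])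
  ultimately have "coeff D m = ladder_b a s (Suc m) / s"
    using sqnorm_pos[OF s, of a m] s by (simp add: ladder_b_def field_simps)
  then show ?thesis
    using D(2)[of m] by simp
qed

subsection \<open>The Hankel determinant\<close>

text \<open>The Hankel matrix is the Gram matrix of the monomials.\<close>

lemma lin_mult_eq_sum:
  assumes "degree p < n" "degree q < n"
  shows "lin a s (p * q) = (\<Sum>i<n. \<Sum>j<n. coeff p i * (moment a s (i + j) * coeff q j))"
proof -
  have rep: "p = (\<Sum>i<n. monom (coeff p i) i)" if "degree p < n" for p :: "real poly"
    using that by (auto simp: poly_eq_iff coeff_sum coeff_eq_0)
  have lin_sum: "lin a s (\<Sum>i\<in>A. f i) = (\<Sum>i\<in>A. lin a s (f i))" if "finite A" for f :: "nat \<Rightarrow> real poly" and A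
    using that by (induction A rule: finite_induct) (simp_all add: lin_add)
  have lin_monom: "lin a s (monom c k) = c * moment a s k" for c k
    using lin_eq_sum[of "monom c k" k a s] by (simp add: degree_monom_le moment_eq_wmom mult_delta_left)
  have "lin a s (p * q) = lin a s ((\<Sum>i<n. monom (coeff p i) i) * (\<Sum>j<n. monom (coeff q j) j))"
    using rep[OF assms(1)] rep[OF assms(2)] by metis
  also have "\<dots> = (\<Sum>i<n. \<Sum>j<n. coeff p i * (moment a s (i + j) * coeff q j))"
    by (simp add: sum_product lin_sum mult_monom lin_monom mult_ac)
  finally show ?thesis .
qed

text \<open>Passing from monomials to the \<open>P i\<close> is a unit lower triangular change of
  basis \<open>A\<close>; it turns the Gram matrix \<open>M\<close> into the diagonal matrix
  \<open>T\<close> without changing the determinant.\<close>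

lemma hankel_det_eq_prod:
  assumes s: "s > 0"
  shows "hankel_det a n s = (\<Prod>j<n. sqnorm a s j)"
proof -
  define M where "M = Matrix.mat n n (\<lambda>(j, k). moment a s (j + k))"
  define A where "A = Matrix.mat n n (\<lambda>(i, j). coeff (ortho a s i) j)"
  define T where "T = Matrix.mat n n (\<lambda>(i, j). if i = j then sqnorm a s i else 0)"
  have carr: "M \<in> carrier_mat n n" "A \<in> carrier_mat n n" "T \<in> carrier_mat n n"
    by (auto simp: M_def A_def T_def)
  have "A * (M * A\<^sup>T) = T"
  proof (rule eq_matI)
    fix i k assume "i < dim_row T" "k < dim_col T"
    then have ik: "i < n" "k < n" by (auto simp: T_def)
    have "(A * (M * A\<^sup>T)) $$ (i, k) = lin a s (ortho a s i * ortho a s k)"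
      using ik by (simp add: lin_mult_eq_sum[of _ n] A_def M_def scalar_prod_def atLeast0LessThan
          sum_distrib_left)
    also have "\<dots> = T $$ (i, k)"
    proof (cases i k rule: linorder_cases)
      case less
      then show ?thesis
        using ortho_pairwise[OF s, of i k a] ik by (simp add: T_def mult.commute)
    next
      case greater
      then show ?thesis
        using ortho_pairwise[OF s, of k i a] ik by (simp add: T_def)
    qed (use ik in \<open>simp add: T_def sqnorm_def\<close>)
    finally show "(A * (M * A\<^sup>T)) $$ (i, k) = T $$ (i, k)" .
  qed (auto simp: A_def T_def)
  moreover have "det (A * (M * A\<^sup>T)) = det A * (det M * det A)"
  proof -
    have AT: "A\<^sup>T \<in> carrier_mat n n"
      by (simp add: A_def)
    have "det (A * (M * A\<^sup>T)) = det A * det (M * A\<^sup>T)"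
      by (rule Determinant.det_mult[OF carr(2) mult_carrier_mat[OF carr(1) AT]])
    also have "det (M * A\<^sup>T) = det M * det A"
      unfolding Determinant.det_mult[OF carr(1) AT] Determinant.det_transpose[OF carr(2)] ..
    finally show ?thesis .
  qed
  ultimately have "det A * (det M * det A) = det T"
    by simp
  moreover have "det A = 1"
    by (subst det_lower_triangular[of n]) (auto simp: A_def prod_list_diag_prod)
  moreover have "det T = (\<Prod>j<n. sqnorm a s j)"
    by (subst det_lower_triangular[of n]) (auto simp: T_def prod_list_diag_prod atLeast0LessThan)
  ultimately show ?thesis
    by (simp add: hankel_det_def M_def)
qed

section \<open>\<open>H\<close> and its first two derivatives in terms of the ladder
  quantities\<close>

lemma H_eq_ladder:
  assumes s: "s > 0"
  shows "H a n s = - (\<Sum>j<n. ladder_a a s j)"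
proof -
  have "((\<lambda>t. \<Sum>j<n. ln (sqnorm a t j)) has_real_derivative
      (\<Sum>j<n. 1 / sqnorm a s j * - (val0 a s j * inv_mean a s j))) (at s)"
    by (intro DERIV_sum DERIV_ln_divide[THEN DERIV_chain2] sqnorm_has_derivative s sqnorm_pos)
  then have "((\<lambda>t. ln (hankel_det a n t)) has_real_derivative
      (\<Sum>j<n. 1 / sqnorm a s j * - (val0 a s j * inv_mean a s j))) (at s)"
  proof (rule has_field_derivative_transform_within_open[where S = "{0<..}"])
    fix t :: real assume "t \<in> {0<..}"
    then have t: "t > 0" by simp
    have "sqnorm a t j \<noteq> 0" for j
      using sqnorm_pos[OF t, of a j] by simp
    then show "(\<Sum>j<n. ln (sqnorm a t j)) = ln (hankel_det a n t)"
      unfolding hankel_det_eq_prod[OF t] by (subst ln_prod) (use sqnorm_pos[OF t] in auto)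
  qed (use s in auto)
  then have "H a n s = s * (\<Sum>j<n. 1 / sqnorm a s j * - (val0 a s j * inv_mean a s j))"
    unfolding H_def by (simp only: DERIV_imp_deriv)
  also have "\<dots> = - (\<Sum>j<n. ladder_a a s j)"
    by (simp add: ladder_a_def sum_distrib_left sum_negf)
  finally show ?thesis .
qed

text \<open>Summing \<open>diag_coeff_eq\<close> turns the sum of the \<open>A j\<close> into the
  subleading coefficient of \<open>P (m+1)\<close>, whose derivative is already known.\<close>

lemma H_Suc_eq_coeff:
  assumes s: "s > 0"
  shows "H a (Suc m) s = real (Suc m) * (real (Suc m) + a) + coeff (ortho a s (Suc m)) m"
proof -
  have "(\<Sum>j<n. diag_coeff a s j) = real n * (real n + a) + (\<Sum>j<n. ladder_a a s j)" for n
    by (induction n) (simp_all add: diag_coeff_eq[OF s] algebra_simps)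
  from this[of "Suc m"] show ?thesis
    unfolding H_eq_ladder[OF s] coeff_ortho_subleading lessThan_Suc_atMost by simp
qed

lemma H_Suc_deriv:
  assumes s: "s > 0"
  shows "(H a (Suc m) has_real_derivative ladder_b a s (Suc m) / s) (at s)"
proof -
  have "((\<lambda>t. real (Suc m) * (real (Suc m) + a) + coeff (ortho a t (Suc m)) m)
      has_real_derivative 0 + ladder_b a s (Suc m) / s) (at s)"
    by (intro DERIV_add DERIV_const coeff_ortho_has_derivative s)
  then show ?thesis
    unfolding add_0
    by (rule has_field_derivative_transform_within_open[where S = "{0<..}"])
       (use s H_Suc_eq_coeff in auto)
qed

lemma off_coeff_has_derivative:
  assumes s: "s > 0"
  shows "((\<lambda>t. off_coeff a t (Suc m)) has_real_derivative
     off_coeff a s (Suc m) * (ladder_a a s m - ladder_a a s (Suc m)) / s) (at s)"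
proof -
  let ?v = "\<lambda>n. val0 a s n * inv_mean a s n" and ?h = "sqnorm a s"
  have h: "?h n > 0" for n using sqnorm_pos[OF s] .
  have "((\<lambda>t. sqnorm a t (Suc m) / sqnorm a t m) has_real_derivative
      (- ?v (Suc m) * ?h m - ?h (Suc m) * - ?v m) / (?h m * ?h m)) (at s)"
    using h[of m] by (intro DERIV_divide sqnorm_has_derivative s) simp
  also have "(- ?v (Suc m) * ?h m - ?h (Suc m) * - ?v m) / (?h m * ?h m)
      = off_coeff a s (Suc m) * (ladder_a a s m - ladder_a a s (Suc m)) / s"
    using h[of m] h[of "Suc m"] s by (simp add: off_coeff_def ladder_a_def field_simps)
  finally show ?thesis
    by (simp add: off_coeff_def)
qed

text \<open>Write \<open>H' = B / s\<close> and replace \<open>B\<close> by \<open>off_coeff\<close>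
  plus the subleading coefficient, both with known derivatives. The derivative \<open>B / s\<close>
  of the latter cancels the term from differentiating \<open>1 / s\<close>.\<close>

lemma H_Suc_deriv2:
  assumes s: "s > 0"
  shows "(deriv (H a (Suc m)) has_real_derivative
     off_coeff a s (Suc m) * (ladder_a a s m - ladder_a a s (Suc m)) / s\<^sup>2) (at s)"
proof -
  let ?o = "\<lambda>t. off_coeff a t (Suc m)" and ?c = "\<lambda>t. coeff (ortho a t (Suc m)) m"
  let ?d = "off_coeff a s (Suc m) * (ladder_a a s m - ladder_a a s (Suc m)) / s"
  have "((\<lambda>t. (?o t + ?c t) / t) has_real_derivative
      ((?d + ladder_b a s (Suc m) / s) * s - (?o s + ?c s) * 1) / (s * s)) (at s)"
    using s by (intro DERIV_divide DERIV_add off_coeff_has_derivative coeff_ortho_has_derivative DERIV_ident) auto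
  also have "((?d + ladder_b a s (Suc m) / s) * s - (?o s + ?c s) * 1) / (s * s) = ?d / s"
    using s off_coeff_eq[OF s, of a m] by (simp add: field_simps)
  finally have "((\<lambda>t. (?o t + ?c t) / t) has_real_derivative ?d / s) (at s)" .
  then have "(deriv (H a (Suc m)) has_real_derivative ?d / s) (at s)"
  proof (rule has_field_derivative_transform_within_open[where S = "{0<..}"])
    fix t :: real assume "t \<in> {0<..}"
    then have t: "t > 0" by simp
    show "(?o t + ?c t) / t = deriv (H a (Suc m)) t"
      unfolding DERIV_imp_deriv[OF H_Suc_deriv[OF t]] off_coeff_eq[OF t] by simp
  qed (use s in auto)
  then show ?thesis by (simp add: power2_eq_square)
qed

theorem theorem3:
  fixes \<alpha> :: real and n :: nat
  assumes "\<alpha> > 0"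
  shows "\<forall>s>0. (s * deriv (deriv (H \<alpha> n)) s)\<^sup>2 =
           (real n - (2 * real n + \<alpha>) * deriv (H \<alpha> n) s)\<^sup>2
           - 4 * (real n * (real n + \<alpha>) + s * deriv (H \<alpha> n) s - H \<alpha> n s)
               * deriv (H \<alpha> n) s * (deriv (H \<alpha> n) s - 1)"
proof (intro allI impI)
  fix s :: real assume s: "s > 0"
  show "(s * deriv (deriv (H \<alpha> n)) s)\<^sup>2 =
           (real n - (2 * real n + \<alpha>) * deriv (H \<alpha> n) s)\<^sup>2
           - 4 * (real n * (real n + \<alpha>) + s * deriv (H \<alpha> n) s - H \<alpha> n s)
               * deriv (H \<alpha> n) s * (deriv (H \<alpha> n) s - 1)"
  proof (cases n)
    case 0
    \<comment> \<open>The empty determinant is 1, so its logarithm vanishes identically.\<close>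
    have "H \<alpha> 0 = (\<lambda>s. 0)"
      by (simp add: fun_eq_iff H_def hankel_det_def)
    then show ?thesis using 0 by simp
  next
    case (Suc m)
    define b where "b = ladder_b \<alpha> s n"
    define \<beta> where "\<beta> = off_coeff \<alpha> s n"
    define A where "A = ladder_a \<alpha> s n"
    define A' where "A' = ladder_a \<alpha> s m"
    have H1: "deriv (H \<alpha> n) s = b / s"
      unfolding Suc b_def by (rule DERIV_imp_deriv[OF H_Suc_deriv[OF s]])
    have H2: "deriv (deriv (H \<alpha> n)) s = \<beta> * (A' - A) / s\<^sup>2"
      unfolding Suc \<beta>_def A_def A'_def by (rule DERIV_imp_deriv[OF H_Suc_deriv2[OF s]])
    have H0: "real n * (real n + \<alpha>) + s * (b / s) - H \<alpha> n s = \<beta>"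
      using H_Suc_eq_coeff[OF s, of \<alpha> m] off_coeff_eq[OF s, of \<alpha> m] s
      unfolding Suc b_def \<beta>_def by simp
    have prod: "\<beta> * A * A' = b * (b - s)"
      using ladder_b_mult[OF s, of \<alpha> n] unfolding Suc b_def \<beta>_def A_def A'_def by simp
    have sum: "\<beta> * (A + A') = real n * s - (2 * real n + \<alpha>) * b"
      using ladder_sum_rule[OF s, of \<alpha> n] unfolding Suc b_def \<beta>_def A_def A'_def by simp
    \<comment> \<open>The identity \<open>(A' - A)^2 = (A + A')^2 - 4 * A * A'\<close> leaves
      exactly the combinations known from \<open>sum\<close> and \<open>prod\<close>.\<close>
    have "(s * (\<beta> * (A' - A) / s\<^sup>2))\<^sup>2 = ((\<beta> * (A + A'))\<^sup>2 - 4 * \<beta> * (\<beta> * A * A')) / s\<^sup>2"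
      using s by (simp add: field_simps power2_eq_square)
    also have "\<dots> = (real n - (2 * real n + \<alpha>) * (b / s))\<^sup>2 - 4 * \<beta> * (b / s) * (b / s - 1)"
      unfolding prod sum using s by (simp add: field_simps power2_eq_square)
    finally show ?thesis
      unfolding H1 H2 H0 .
  qed
qed

end
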